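(* Let $(X,\mathcal{C}_0,\mathcal{F},\tau)$ be a measurable locally convex space, $D$ a convex subset of $X$, $\mu$ a probability measure on $(X,\mathcal{F})$ carried by $D$, $(\mu_n)_{n\ge1}$ the Cramér sequence associated with $\mu$, $s$ its entropy and $p$ its pressure. Suppose that $\mu$ is convex-tight on $D$. Then the pressure is the convex conjugate of the opposite of the entropy, i.e. $$\forall\lambda\in X^*\qquad p(\lambda)=\sup_{x\in X}\big(\langle\lambda|x\rangle+s(x)\big).$$
   Context: **Measurable locally convex space.** Let $X$ be a real vector space. For a convex set $C\subset X$ containing $0$, its gauge is $M_C(x)=\inf\{t\ge0: x\in tC\}\in[0,+\infty]$. $C$ is an internal convex set if $M_C$ is finite everywhere and $C=\{x\in X: M_C(x)<1\}$. For such $C$, $\tau_C$ denotes the (not necessarily Hausdorff) locally convex topology on $X$ generated by the neighbourhoods $tC$, $t\in\mathbb{R}\setminus\{0\}$, of $0$. A measurable locally convex space is a quadruple $(X,\mathcal{C}_0,\mathcal{F},\tau)$ where $\mathcal{C}_0$ is a family of convex subsets of $X$ such that: (i) every $C\in\mathcal{C}_0$ is an internal convex set, symmetric ($C=-C$), and $\tau_C$ is separable; (ii) $\mathcal{C}_0$ is stable under finite intersections and under dilations $C\mapsto tC$, $t\ne0$; (iii) the intersection of all elements of $\mathcal{C}_0$ is $\{0\}$. Then $\tau$ is the Hausdorff locally convex topology having $\mathcal{C}_0$ as a fundamental system of neighbourhoods of $0$; $\mathcal{C}_x=\{x+C: C\in\mathcal{C}_0\}$; and $\mathcal{F}=\sigma\big(\bigcup_{x\in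 X}\mathcal{C}_x\big)$. Topological notions (including the topological dual $X^*$) refer to $\tau$. Vector addition $X^2\to X$ is $\mathcal{F}^{\otimes2}$-$\mathcal{F}$ measurable and every $\lambda\in X^*$ is $\mathcal{F}$-measurable. **Cramér sequence, entropy, pressure.** Given a probability $\mu$ on $\mathcal{F}$, let $(X_n)_{n\ge1}$ be i.i.d. with law $\mu$, $\overline{X}_n=\frac1n\sum_{k=1}^nX_k$, and $\mu_n$ the law of $\overline{X}_n$; $(\mu_n)_{n\ge1}$ is the Cramér sequence associated with $\mu$. Its entropy is $s:X\to[-\infty,0]$, $s(x)=\inf_{C\in\mathcal{C}_x}\liminf_{n\to\infty}\frac1n\log\mu_n(C)$ (with $\log 0=-\infty$). Its pressure is $p(\lambda)=\log\mathbb{E}\big(e^{\langle\lambda|X_1\rangle}\big)$, $\lambda\in X^*$. **Carried, convex-tight.** $\mu$ is carried by $D\subset X$ if for all $A,B\in\mathcal{F}$, $A\cap D=B\cap D$ implies $\mu(A)=\mu(B)$. $\mu$ is convex-tight on $D$ if there is a sequence $(K_m)_{m\ge1}$ in $\mathcal{F}$ such that each $K_m\cap D$ is convex and relatively compact (contained in a compact set), and $\lim_m\mu(K_m)=1$. *)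

theory Defs
  imports "HOL-Probability.Probability"
begin

text \<open>
  The real vector space \<open>X\<close> is the type \<open>'a :: real_vector\<close>, which carries no topology of
  its own; topologies on it are values of type \<open>'a topology\<close>.
\<close>

definition minkowski_gauge :: "'a::real_vector set \<Rightarrow> 'a \<Rightarrow> ereal" where
  "minkowski_gauge C x = Inf (ereal ` {t. 0 \<le> t \<and> x \<in> (*\<^sub>R) t ` C})"

definition internal_convex :: "'a::real_vector set \<Rightarrow> bool" where
  "internal_convex C \<longleftrightarrow> convex C \<and> 0 \<in> C \<and>
     (\<forall>x. minkowski_gauge C x < \<infinity>) \<and> C = {x. minkowski_gauge C x < 1}"

text \<open>
  For an internal convex set \<open>C\<close> the sets \<open>x + t C\<close> with \<open>t \<noteq> 0\<close> are open in the topology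
  having the \<open>t C\<close> as neighbourhoods of \<open>0\<close>, so they form a subbase of it.
\<close>

definition gauge_topology :: "'a::real_vector set \<Rightarrow> 'a topology" where
  "gauge_topology C = topology_generated_by {(\<lambda>y. x + t *\<^sub>R y) ` C |x t. t \<noteq> 0}"

definition translates :: "'a::real_vector set set \<Rightarrow> 'a \<Rightarrow> 'a set set" where
  "translates \<C>\<^sub>0 x = (\<lambda>C. (+) x ` C) ` \<C>\<^sub>0"

text \<open>
  Stability under finite intersections is stability under binary ones together with
  \<open>\<C>\<^sub>0 \<noteq> {}\<close>; the latter is implicit in \<open>\<C>\<^sub>0\<close> being a fundamental system of neighbourhoods,
  but is not implied by \<open>\<Inter>\<C>\<^sub>0 = {0}\<close> when \<open>X = {0}\<close>, because \<open>\<Inter>{} = UNIV\<close>.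
  That \<open>\<tau>\<close> is Hausdorff and locally convex, and that addition and the continuous linear
  functionals are measurable, are consequences and not requirements.
\<close>

locale measurable_lcs =
  fixes \<C>\<^sub>0 :: "'a::real_vector set set" and \<F> :: "'a set set" and \<tau> :: "'a topology"
  assumes nonempty: "\<C>\<^sub>0 \<noteq> {}"
    and internal: "C \<in> \<C>\<^sub>0 \<Longrightarrow> internal_convex C"
    and symmetric: "C \<in> \<C>\<^sub>0 \<Longrightarrow> uminus ` C = C"
    and separable: "C \<in> \<C>\<^sub>0 \<Longrightarrow> separable_space (gauge_topology C)"
    and Int_closed: "A \<in> \<C>\<^sub>0 \<Longrightarrow> B \<in> \<C>\<^sub>0 \<Longrightarrow> A \<inter> B \<in> \<C>\<^sub>0"
    and dilation_closed: "C \<in> \<C>\<^sub>0 \<Longrightarrow> t \<noteq> 0 \<Longrightarrow> (*\<^sub>R) t ` C \<in> \<C>\<^sub>0"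
    and Inter_eq: "\<Inter>\<C>\<^sub>0 = {0}"
    and openin_iff: "openin \<tau> U \<longleftrightarrow> (\<forall>x\<in>U. \<exists>C\<in>\<C>\<^sub>0. (+) x ` C \<subseteq> U)"
    and sigma_eq: "\<F> = sigma_sets UNIV (\<Union>x. translates \<C>\<^sub>0 x)"

definition topological_dual :: "'a::real_vector topology \<Rightarrow> ('a \<Rightarrow> real) set" where
  "topological_dual \<tau> = {f. linear f \<and> continuous_map \<tau> euclideanreal f}"

definition ext_log :: "ennreal \<Rightarrow> ereal" where
  "ext_log u = (if u = 0 then -\<infinity> else if u = \<top> then \<infinity> else ereal (ln (enn2real u)))"

definition iid_sequence ::
    "'w measure \<Rightarrow> 'a measure \<Rightarrow> (nat \<Rightarrow> 'w \<Rightarrow> 'a) \<Rightarrow> bool" where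
  "iid_sequence M \<mu> X \<longleftrightarrow> prob_space M \<and> prob_space.indep_vars M (\<lambda>_. \<mu>) X {1..} \<and>
     (\<forall>n\<ge>1. distr M \<mu> (X n) = \<mu>)"

definition cramer_sequence ::
    "'w measure \<Rightarrow> 'a::real_vector measure \<Rightarrow> (nat \<Rightarrow> 'w \<Rightarrow> 'a) \<Rightarrow> nat \<Rightarrow> 'a measure" where
  "cramer_sequence M \<mu> X n = distr M \<mu> (\<lambda>\<omega>. (1 / real n) *\<^sub>R (\<Sum>k=1..n. X k \<omega>))"

definition entropy ::
    "'a::real_vector set set \<Rightarrow> (nat \<Rightarrow> 'a measure) \<Rightarrow> 'a \<Rightarrow> ereal" where
  "entropy \<C>\<^sub>0 \<mu>s x =
     (INF C\<in>translates \<C>\<^sub>0 x. liminf (\<lambda>n. ereal (1 / real n) * ext_log (emeasure (\<mu>s n) C)))"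

text \<open>
  The expectation is taken in \<open>[0, \<infinity>]\<close>, so the pressure may be \<open>\<infinity>\<close>.
\<close>

definition pressure ::
    "'w measure \<Rightarrow> (nat \<Rightarrow> 'w \<Rightarrow> 'a) \<Rightarrow> ('a \<Rightarrow> real) \<Rightarrow> ereal" where
  "pressure M X f = ext_log (\<integral>\<^sup>+ \<omega>. ennreal (exp (f (X 1 \<omega>))) \<partial>M)"

text \<open>\<open>D\<close> need not be measurable in the following two definitions.\<close>

definition carried_by :: "'a measure \<Rightarrow> 'a set \<Rightarrow> bool" where
  "carried_by \<mu> D \<longleftrightarrow>
     (\<forall>A\<in>sets \<mu>. \<forall>B\<in>sets \<mu>. A \<inter> D = B \<inter> D \<longrightarrow> emeasure \<mu> A = emeasure \<mu> B)"

definition convex_tight_on ::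
    "'a::real_vector topology \<Rightarrow> 'a measure \<Rightarrow> 'a set \<Rightarrow> bool" where
  "convex_tight_on \<tau> \<mu> D \<longleftrightarrow>
     (\<exists>K :: nat \<Rightarrow> 'a set.
        (\<forall>m\<ge>1. K m \<in> sets \<mu> \<and> convex (K m \<inter> D) \<and> (\<exists>L. compactin \<tau> L \<and> K m \<inter> D \<subseteq> L)) \<and>
        (\<lambda>m. measure \<mu> (K m)) \<longlonglongrightarrow> 1)"

end

theory Submission
  imports Defs "HOL-Real_Asymp.Real_Asymp"
begin

text \<open>
  The inequality \<open>\<ge>\<close> is Markov's inequality on a neighbourhood where \<open>\<lambda>\<close> is almost constant.
  For \<open>\<le>\<close>, let \<open>a\<close> exceed the supremum and let \<open>K \<inter> D\<close> be convex and relatively compact.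
  Supermultiplicativity of \<open>n \<mapsto> P(S\<^sub>n \<in> n(x + C))\<close> turns the bound on the lower limit that
  defines the entropy at \<open>x\<close> into a bound valid for all \<open>n\<close> on the smaller neighbourhood
  \<open>x + C/2\<close>. If all steps lie in \<open>K \<inter> D\<close>, then so does their mean, by convexity; covering
  \<open>K \<inter> D\<close> by finitely many such neighbourhoods, \<open>N\<close> say, gives
  \<open>(\<integral>\<^sub>K exp \<lambda> d\<mu>)\<^sup>n \<le> N exp (n a)\<close> for every \<open>n\<close>, hence \<open>\<integral>\<^sub>K exp \<lambda> d\<mu> \<le> exp a\<close>, and \<open>K\<close> is
  exhausted by convex tightness.
\<close>

section \<open>Internal convex sets\<close>

text \<open>\<open>u + v\<close> is \<open>s + t\<close> times a convex combination with weights
  \<open>s / (s + t)\<close> and \<open>t / (s + t)\<close>; only \<open>s = t = 0\<close> has to be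
  treated apart. All later arithmetic of radii rests on this.\<close>

lemma convex_cone_add:
  assumes "convex C" "0 \<le> s" "0 \<le> t" "u \<in> (*\<^sub>R) s ` C" "v \<in> (*\<^sub>R) t ` C"
  shows "u + v \<in> (*\<^sub>R) (s + t) ` C"
proof -
  obtain c d where cd: "c \<in> C" "d \<in> C" "u = s *\<^sub>R c" "v = t *\<^sub>R d"
    using assms by auto
  show ?thesis
  proof (cases "s + t = 0")
    case True
    then have "s = 0" "t = 0" using assms by auto
    then show ?thesis using cd by auto
  next
    case False
    then have pos: "s + t > 0" using assms by auto
    have "(s / (s + t)) *\<^sub>R c + (t / (s + t)) *\<^sub>R d \<in> C"
      using assms(1-3) cd pos by (intro convexD) (auto simp: add_divide_distrib[symmetric])
    moreover have "u + v = (s + t) *\<^sub>R ((s / (s + t)) *\<^sub>R c + (t / (s + t)) *\<^sub>R d)"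
      using pos cd by (simp add: scaleR_right_distrib)
    ultimately show ?thesis by blast
  qed
qed

lemma convex_cone_mono:
  assumes "convex C" "0 \<in> C" "0 \<le> s" "s \<le> t" "u \<in> (*\<^sub>R) s ` C"
  shows "u \<in> (*\<^sub>R) t ` C"
proof -
  have "u + 0 \<in> (*\<^sub>R) (s + (t - s)) ` C"
    using assms by (intro convex_cone_add) (auto intro: image_eqI[of _ _ 0])
  then show ?thesis by simp
qed

lemma scaleR_image_iff:
  fixes C :: "'a::real_vector set"
  assumes "t \<noteq> 0"
  shows "x \<in> (*\<^sub>R) t ` C \<longleftrightarrow> (1 / t) *\<^sub>R x \<in> C"
  using assms by (force intro: image_eqI[of _ _ "(1 / t) *\<^sub>R x"])

lemma translate_image_iff:
  fixes C :: "'a::ab_group_add set"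
  shows "z \<in> (+) x ` C \<longleftrightarrow> z - x \<in> C"
  by (force intro: image_eqI[of _ _ "z - x"])

text \<open>This is c + tC. Separating centre and radius suits sums better than means: centres and
  radii add under addition, and the mean of \<open>n\<close> steps lies in x + C exactly if their
  sum lies in the cell with centre nx and radius \<open>n\<close>.\<close>

definition cell :: "'a::real_vector set \<Rightarrow> 'a \<Rightarrow> real \<Rightarrow> 'a set" where
  "cell C c t = {z. z - c \<in> (*\<^sub>R) t ` C}"

lemma translate_eq_cell:
  fixes C :: "'a::real_vector set"
  assumes "r > 0"
  shows "{z. (1 / r) *\<^sub>R z \<in> (+) x ` C} = cell C (r *\<^sub>R x) r"
  using assms by (simp add: cell_def translate_image_iff scaleR_image_iff scaleR_diff_right)

section \<open>Extended logarithm and exponential rates\<close>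

lemma ext_log_exp: "ext_log (ennreal (exp y)) = ereal y"
  by (simp add: ext_log_def)

lemma ext_log_mono: "u \<le> v \<Longrightarrow> ext_log u \<le> ext_log v"
  by (cases u; cases v) (auto simp: ext_log_def ennreal_eq_0_iff top_unique)

text \<open>A factor independent of \<open>n\<close> does not affect an exponential rate: if
  \<open>c\<close> exceeded \<open>exp a\<close>, the powers of the quotient would outgrow
  \<open>N\<close>. The instance \<open>n = 1\<close> shows first that \<open>c\<close> is finite,
  so that the quotient is a real number.\<close>

lemma le_exp_if_powers_le:
  assumes "\<And>n. n \<ge> 1 \<Longrightarrow> c ^ n \<le> of_nat N * ennreal (exp (real n * a))"
  shows "c \<le> ennreal (exp a)"
proof (rule ccontr)
  assume "\<not> c \<le> ennreal (exp a)"
  then have gt: "ennreal (exp a) < c" by simp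
  have "c \<le> of_nat N * ennreal (exp a)" using assms[of 1] by simp
  also have "\<dots> < \<infinity>" by (simp add: ennreal_mult_less_top of_nat_less_top)
  finally obtain q where q: "c = ennreal q" "0 \<le> q" by (cases c) auto
  have "1 < q / exp a" using gt q by (simp add: ennreal_less_iff field_simps)
  then obtain n where n: "real N < (q / exp a) ^ n" using real_arch_pow by blast
  \<comment> \<open>The Archimedean property may return exponent 0, to which the hypothesis does not
    apply; passing to \<open>Suc n\<close> avoids this.\<close>
  have "real N * exp a ^ Suc n < q ^ Suc n"
  proof -
    have "real N < (q / exp a) ^ Suc n"
      using n \<open>1 < q / exp a\<close> by (meson less_le_trans power_increasing le_SucI order_refl less_imp_le)
    then show ?thesis by (simp add: field_simps)
  qed
  moreover have "q ^ Suc n \<le> real N * exp a ^ Suc n"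
  proof -
    have "ennreal (q ^ Suc n) = c ^ Suc n" by (simp only: q(1) ennreal_power[OF q(2)])
    also have "\<dots> \<le> of_nat N * ennreal (exp (real (Suc n) * a))" by (rule assms) simp
    also have "\<dots> = ennreal (real N * exp a ^ Suc n)"
      unfolding exp_of_nat_mult ennreal_of_nat_eq_real_of_nat by (rule ennreal_mult[symmetric]) auto
    finally show ?thesis by (subst (asm) ennreal_le_iff) auto
  qed
  ultimately show False by simp
qed

section \<open>Neighbourhoods in a measurable locally convex space\<close>

context measurable_lcs
begin

lemma convex: "C \<in> \<C>\<^sub>0 \<Longrightarrow> convex C"
  and zero_mem: "C \<in> \<C>\<^sub>0 \<Longrightarrow> 0 \<in> C"
  using internal by (auto simp: internal_convex_def)

lemma minus_mem: "C \<in> \<C>\<^sub>0 \<Longrightarrow> x \<in> C \<Longrightarrow> - x \<in> C"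
  using symmetric by blast

lemma minus_mem_scaled: "C \<in> \<C>\<^sub>0 \<Longrightarrow> x \<in> (*\<^sub>R) t ` C \<Longrightarrow> - x \<in> (*\<^sub>R) t ` C"
  using minus_mem by (auto intro!: image_eqI[of _ _ "- _"])

lemma absorbing:
  assumes "C \<in> \<C>\<^sub>0"
  shows "\<exists>t>0. x \<in> (*\<^sub>R) t ` C"
proof -
  have "minkowski_gauge C x < \<infinity>" using internal[OF assms] by (auto simp: internal_convex_def)
  then obtain t where t: "0 \<le> t" "x \<in> (*\<^sub>R) t ` C"
    unfolding minkowski_gauge_def Inf_less_iff by auto
  have "x \<in> (*\<^sub>R) (t + 1) ` C"
    using t convex_cone_mono[OF convex zero_mem, OF assms assms, of t "t + 1"] by simp
  then show ?thesis using t by (intro exI[of _ "t + 1"]) auto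
qed

text \<open>This uses that \<open>C\<close> consists exactly of the points of gauge below 1. The
  slack \<open>1 - t\<close> is what makes translates open and addition measurable.\<close>

lemma mem_shrink:
  assumes "C \<in> \<C>\<^sub>0" "x \<in> C"
  shows "\<exists>t. 0 < t \<and> t < 1 \<and> x \<in> (*\<^sub>R) t ` C"
proof -
  have "minkowski_gauge C x < 1" using internal[OF assms(1)] assms(2) by (auto simp: internal_convex_def)
  then obtain t where t: "0 \<le> t" "t < 1" "x \<in> (*\<^sub>R) t ` C"
    by (auto simp: minkowski_gauge_def Inf_less_iff one_ereal_def)
  \<comment> \<open>The infimum only yields \<open>t \<ge> 0\<close>; the midpoint of
    \<open>t\<close> and 1 is positive and still below 1.\<close>
  have "x \<in> (*\<^sub>R) ((t + 1) / 2) ` C"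
    using t convex_cone_mono[OF convex zero_mem, OF assms(1) assms(1), of t "(t + 1) / 2"] by simp
  then show ?thesis using t by (intro exI[of _ "(t + 1) / 2"]) auto
qed

lemma cell_mono:
  assumes "C \<in> \<C>\<^sub>0" "0 \<le> s" "s \<le> t"
  shows "cell C c s \<subseteq> cell C c t"
  using convex_cone_mono[OF convex[OF assms(1)] zero_mem[OF assms(1)] assms(2,3)]
  unfolding cell_def by blast

lemma openin_translate:
  assumes "C \<in> \<C>\<^sub>0"
  shows "openin \<tau> ((+) x ` C)"
  unfolding openin_iff
proof
  fix y assume "y \<in> (+) x ` C"
  then obtain c where c: "c \<in> C" "y = x + c" by auto
  obtain t where t: "0 < t" "t < 1" "c \<in> (*\<^sub>R) t ` C" using mem_shrink[OF assms c(1)] by auto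
  \<comment> \<open>The slack around \<open>c\<close> leaves room for the dilate of \<open>C\<close>
    by \<open>1 - t\<close>.\<close>
  have "(+) y ` (*\<^sub>R) (1 - t) ` C \<subseteq> (+) x ` C"
  proof clarify
    fix d assume "d \<in> C"
    then have "c + (1 - t) *\<^sub>R d \<in> (*\<^sub>R) (t + (1 - t)) ` C"
      using t convex[OF assms] by (intro convex_cone_add) auto
    then show "y + (1 - t) *\<^sub>R d \<in> (+) x ` C" using c by (auto simp: add.assoc)
  qed
  then show "\<exists>C'\<in>\<C>\<^sub>0. (+) y ` C' \<subseteq> (+) x ` C"
    using dilation_closed[OF assms, of "1 - t"] t by auto
qed

lemma translate_sets:
  assumes "C \<in> \<C>\<^sub>0"
  shows "(+) x ` C \<in> \<F>"
  unfolding sigma_eq using assms by (auto simp: translates_def)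

lemma scaled_translate_sets:
  assumes "C \<in> \<C>\<^sub>0" "t \<noteq> 0"
  shows "{z. z - x \<in> (*\<^sub>R) t ` C} \<in> \<F>"
proof -
  have "{z. z - x \<in> (*\<^sub>R) t ` C} = (+) x ` (*\<^sub>R) t ` C"
    by (auto simp: translate_image_iff)
  then show ?thesis using translate_sets[OF dilation_closed[OF assms]] by simp
qed

text \<open>Density in \<open>gauge_topology C\<close>, stated through dilates. One countable
  \<open>Q\<close> serves all points and all radii, so unions indexed by \<open>Q\<close> and
  rational radii stay countable.\<close>

lemma countable_dense:
  assumes "C \<in> \<C>\<^sub>0"
  obtains Q where "countable Q" "\<And>y t. t \<noteq> 0 \<Longrightarrow> \<exists>q\<in>Q. q - y \<in> (*\<^sub>R) t ` C"
proof -
  obtain Q where Q: "countable Q" "gauge_topology C closure_of Q = topspace (gauge_topology C)"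
    using separable[OF assms] by (auto simp: separable_space_def)
  have "\<exists>q\<in>Q. q - y \<in> (*\<^sub>R) t ` C" if "t \<noteq> 0" for y t
  proof -
    define U where "U = (\<lambda>z. y + t *\<^sub>R z) ` C"
    have "U \<in> {(\<lambda>y. x + t *\<^sub>R y) ` C |x t. t \<noteq> 0}" unfolding U_def using that by blast
    then have op: "openin (gauge_topology C) U"
      unfolding gauge_topology_def by (rule topology_generated_by_Basis)
    have y: "y \<in> U" using zero_mem[OF assms] by (auto simp: U_def intro: image_eqI[of _ _ 0])
    then have "y \<in> gauge_topology C closure_of Q" using openin_subset[OF op] Q(2) by blast
    then obtain q where "q \<in> Q" "q \<in> U" using op y unfolding in_closure_of by blast
    then show ?thesis by (intro bexI[of _ q]) (auto simp: U_def)
  qed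
  then show thesis using that Q(1) by blast
qed

lemma dual_small:
  assumes "f \<in> topological_dual \<tau>" "e > 0"
  obtains C where "C \<in> \<C>\<^sub>0" "\<And>z. z \<in> C \<Longrightarrow> \<bar>f z\<bar> < e"
proof -
  have lin: "linear f" and cont: "continuous_map \<tau> euclideanreal f"
    using assms(1) by (auto simp: topological_dual_def)
  \<comment> \<open>\<open>openin_iff\<close> says nothing about \<open>topspace \<tau>\<close>;
    that it is the whole space comes from \<open>\<C>\<^sub>0\<close> being nonempty.\<close>
  have "openin \<tau> UNIV" using nonempty by (auto simp: openin_iff)
  then have top: "topspace \<tau> = UNIV" by (meson openin_subset top.extremum_unique)
  have "openin \<tau> {z \<in> topspace \<tau>. f z \<in> {-e<..<e}}"
    using cont by (rule openin_continuous_map_preimage) auto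
  then have "openin \<tau> {z. \<bar>f z\<bar> < e}" by (simp add: top abs_less_iff conj_commute minus_less_iff)
  moreover have "0 \<in> {z. \<bar>f z\<bar> < e}" using linear_0[OF lin] assms(2) by simp
  ultimately obtain C where "C \<in> \<C>\<^sub>0" "(+) 0 ` C \<subseteq> {z. \<bar>f z\<bar> < e}"
    unfolding openin_iff by meson
  then show thesis using that by auto
qed

end

section \<open>Measurability\<close>

locale measurable_lcs_prob = measurable_lcs \<C>\<^sub>0 \<F> \<tau> + prob_space \<mu>
  for \<C>\<^sub>0 :: "'a::real_vector set set" and \<F> :: "'a set set" and \<tau> :: "'a topology"
    and \<mu> :: "'a measure" +
  assumes sets_mu: "sets \<mu> = \<F>"
begin

lemma space_mu: "space \<mu> = UNIV"
proof -
  have "UNIV \<in> \<F>" unfolding sigma_eq by (rule sigma_sets_top)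
  then show ?thesis using sets_mu sets.sets_into_space by blast
qed

lemma measurable_muI:
  assumes "\<And>x C. C \<in> \<C>\<^sub>0 \<Longrightarrow> g -` ((+) x ` C) \<inter> space N \<in> sets N"
  shows "g \<in> N \<rightarrow>\<^sub>M \<mu>"
  by (rule measurable_sigma_sets[OF sets_mu[unfolded sigma_eq]])
     (use assms in \<open>auto simp: translates_def\<close>)

text \<open>The preimage of a translate x + C is a countable union of measurable rectangles:
  \<open>y\<close> in a cell of rational radius \<open>d\<close> around a point \<open>q\<close> of
  a dense set, and \<open>z\<close> in the cell of radius \<open>1 - d\<close> around
  \<open>x - q\<close>.\<close>

lemma measurable_add_pair: "(\<lambda>(y, z). y + z) \<in> \<mu> \<Otimes>\<^sub>M \<mu> \<rightarrow>\<^sub>M \<mu>"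
proof (rule measurable_muI)
  fix x C assume C: "C \<in> \<C>\<^sub>0"
  obtain Q where Q: "countable Q" "\<And>y t. t \<noteq> 0 \<Longrightarrow> \<exists>q\<in>Q. q - y \<in> (*\<^sub>R) t ` C"
    using countable_dense[OF C] by blast
  define I where "I = Q \<times> {d::real. d \<in> \<rat> \<and> 0 < d \<and> d < 1}"
  define R where "R = (\<lambda>(q, d). {y. y - q \<in> (*\<^sub>R) d ` C} \<times> {z. z - (x - q) \<in> (*\<^sub>R) (1 - d) ` C})"
  have "(\<lambda>(y, z). y + z) -` ((+) x ` C) = (\<Union>i\<in>I. R i)"
  proof (intro equalityI subsetI)
    fix p assume "p \<in> (\<lambda>(y, z). y + z) -` ((+) x ` C)"
    then obtain y z where p: "p = (y, z)" and "y + z - x \<in> C" by (cases p) auto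
    then obtain t where t: "0 < t" "t < 1" "y + z - x \<in> (*\<^sub>R) t ` C"
      using mem_shrink[OF C] by blast
    \<comment> \<open>Replacing \<open>y\<close> by \<open>q\<close> enlarges the radius
      \<open>t\<close> to \<open>t + d\<close>, which has to fit into \<open>1 - d\<close>.\<close>
    obtain d where d: "d \<in> \<rat>" "0 < d" "d < (1 - t) / 2"
      using Rats_dense_in_real[of 0 "(1 - t) / 2"] t by auto
    obtain q where q: "q \<in> Q" "q - y \<in> (*\<^sub>R) d ` C" using Q(2)[of d y] d by auto
    have "(y + z - x) + (q - y) \<in> (*\<^sub>R) (t + d) ` C"
      using convex_cone_add[OF convex[OF C] _ _ t(3) q(2)] t d by simp
    then have "(y + z - x) + (q - y) \<in> (*\<^sub>R) (1 - d) ` C"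
      using convex_cone_mono[OF convex[OF C] zero_mem[OF C], of "t + d" "1 - d"] t d by simp
    moreover have "y - q \<in> (*\<^sub>R) d ` C" using minus_mem_scaled[OF C q(2)] by simp
    ultimately have "p \<in> R (q, d)" by (simp add: R_def p algebra_simps)
    moreover have "(q, d) \<in> I" using q(1) d t(1) by (auto simp: I_def)
    ultimately show "p \<in> (\<Union>i\<in>I. R i)" by blast
  next
    fix p assume "p \<in> (\<Union>i\<in>I. R i)"
    then obtain q d where qd: "(q, d) \<in> I" "p \<in> R (q, d)" by auto
    obtain y z where p: "p = (y, z)" by (cases p)
    have "(y - q) + (z - (x - q)) \<in> (*\<^sub>R) (d + (1 - d)) ` C"
      using qd convex[OF C] by (intro convex_cone_add) (auto simp: I_def R_def p)
    then have "y + z - x \<in> C" by (simp add: algebra_simps)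
    then show "p \<in> (\<lambda>(y, z). y + z) -` ((+) x ` C)"
      by (simp add: p translate_image_iff)
  qed
  moreover have "(\<Union>i\<in>I. R i) \<in> sets (\<mu> \<Otimes>\<^sub>M \<mu>)"
  proof (rule sets.countable_UN'')
    show "countable I" unfolding I_def
      by (intro countable_SIGMA Q(1)) (auto intro: countable_subset[OF _ countable_rat])
    show "R i \<in> sets (\<mu> \<Otimes>\<^sub>M \<mu>)" if "i \<in> I" for i
      using that scaled_translate_sets[OF C] by (auto simp: I_def R_def sets_mu intro!: pair_measureI)
  qed
  ultimately show "(\<lambda>(y, z). y + z) -` ((+) x ` C) \<inter> space (\<mu> \<Otimes>\<^sub>M \<mu>) \<in> sets (\<mu> \<Otimes>\<^sub>M \<mu>)"
    by (simp add: space_pair_measure space_mu)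
qed

lemma measurable_add [measurable]:
  assumes [measurable]: "g \<in> N \<rightarrow>\<^sub>M \<mu>" "h \<in> N \<rightarrow>\<^sub>M \<mu>"
  shows "(\<lambda>x. g x + h x) \<in> N \<rightarrow>\<^sub>M \<mu>"
  using measurable_compose[OF measurable_Pair[OF assms] measurable_add_pair] by simp

lemma measurable_scaleR [measurable]:
  assumes [measurable]: "g \<in> N \<rightarrow>\<^sub>M \<mu>" and "c \<noteq> 0"
  shows "(\<lambda>x. c *\<^sub>R g x) \<in> N \<rightarrow>\<^sub>M \<mu>"
proof -
  have "(*\<^sub>R) c \<in> \<mu> \<rightarrow>\<^sub>M \<mu>"
  proof (rule measurable_muI)
    fix x C assume C: "C \<in> \<C>\<^sub>0"
    have "(*\<^sub>R) c -` ((+) x ` C) = {z. z - (1 / c) *\<^sub>R x \<in> (*\<^sub>R) (1 / c) ` C}"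
      using \<open>c \<noteq> 0\<close>
      by (simp add: scaleR_image_iff scaleR_diff_right vimage_def translate_image_iff)
    then show "(*\<^sub>R) c -` ((+) x ` C) \<inter> space \<mu> \<in> sets \<mu>"
      using scaled_translate_sets[OF C, of "1 / c"] \<open>c \<noteq> 0\<close> by (simp add: space_mu sets_mu)
  qed
  then show ?thesis using measurable_compose[OF assms(1)] by simp
qed

lemma zero_measurable [measurable]: "(\<lambda>_. 0) \<in> N \<rightarrow>\<^sub>M \<mu>"
  by (simp add: space_mu)

lemma measurable_sum [measurable]:
  assumes "\<And>i. i \<in> I \<Longrightarrow> g i \<in> N \<rightarrow>\<^sub>M \<mu>"
  shows "(\<lambda>x. \<Sum>i\<in>I. g i x) \<in> N \<rightarrow>\<^sub>M \<mu>"
  using assms by (induction I rule: infinite_finite_induct) auto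

text \<open>Again by a countable union: where \<open>f\<close> is below 1 in absolute value on
  \<open>C\<close>, it varies by less than \<open>d\<close> on a cell of radius \<open>d\<close>, so
  the cells around \<open>q\<close> with \<open>a + d < f q\<close> stay inside the superlevel
  set.\<close>

lemma dual_measurable:
  assumes f: "f \<in> topological_dual \<tau>"
  shows "f \<in> borel_measurable \<mu>"
  unfolding borel_measurable_iff_greater
proof
  fix a :: real
  have lin: "linear f" using f by (auto simp: topological_dual_def)
  obtain C where C: "C \<in> \<C>\<^sub>0" "\<And>z. z \<in> C \<Longrightarrow> \<bar>f z\<bar> < 1" using dual_small[OF f, of 1] by auto
  have bd: "\<bar>f z\<bar> < t" if z: "z \<in> (*\<^sub>R) t ` C" "0 < t" for z t
  proof -
    obtain c where c: "c \<in> C" "z = t *\<^sub>R c" using z(1) by blast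
    then show ?thesis using C(2)[OF c(1)] z(2) by (simp add: linear_cmul[OF lin] abs_mult)
  qed
  obtain Q where Q: "countable Q" "\<And>y t. t \<noteq> 0 \<Longrightarrow> \<exists>q\<in>Q. q - y \<in> (*\<^sub>R) t ` C"
    using countable_dense[OF C(1)] by blast
  define I where "I = {(q, d). q \<in> Q \<and> d \<in> \<rat> \<and> 0 < d \<and> a + d < f q}"
  define R where "R = (\<lambda>(q, d). {z. z - q \<in> (*\<^sub>R) d ` C})"
  have "{w. a < f w} = (\<Union>i\<in>I. R i)"
  proof (intro equalityI subsetI)
    fix y assume "y \<in> {w. a < f w}"
    \<comment> \<open>One \<open>d\<close> is lost in passing from \<open>f y\<close> to
      \<open>f q\<close>, another is demanded by \<open>I\<close>.\<close>
    then obtain d where d: "d \<in> \<rat>" "0 < d" "d < (f y - a) / 2"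
      using Rats_dense_in_real[of 0 "(f y - a) / 2"] by auto
    obtain q where q: "q \<in> Q" "q - y \<in> (*\<^sub>R) d ` C" using Q(2)[of d y] d by auto
    have "\<bar>f q - f y\<bar> < d" using bd[OF q(2)] d by (simp add: linear_diff[OF lin])
    then have "(q, d) \<in> I" using q d by (auto simp: I_def field_simps)
    moreover have "y \<in> R (q, d)" using minus_mem_scaled[OF C(1) q(2)] by (simp add: R_def)
    ultimately show "y \<in> (\<Union>i\<in>I. R i)" by blast
  next
    fix y assume "y \<in> (\<Union>i\<in>I. R i)"
    then obtain q d where qd: "(q, d) \<in> I" "y - q \<in> (*\<^sub>R) d ` C" by (auto simp: R_def)
    then have "\<bar>f y - f q\<bar> < d" using bd[OF qd(2)] by (simp add: linear_diff[OF lin] I_def)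
    then show "y \<in> {w. a < f w}" using qd by (auto simp: I_def)
  qed
  moreover have "(\<Union>i\<in>I. R i) \<in> sets \<mu>"
  proof (rule sets.countable_UN'')
    show "countable I"
      by (rule countable_subset[OF _ countable_SIGMA[OF Q(1) countable_rat]]) (auto simp: I_def)
    show "R i \<in> sets \<mu>" if "i \<in> I" for i
      using that scaled_translate_sets[OF C(1)] by (auto simp: I_def R_def sets_mu)
  qed
  ultimately show "{w \<in> space \<mu>. a < f w} \<in> sets \<mu>" by (simp add: space_mu)
qed


section \<open>Random walks with steps restricted to a set\<close>

text \<open>
  Iterating \<open>step K\<close> replaces the \<open>n\<close>-fold product measure: \<open>walk K n g x\<close> is the expectation of
  \<open>g (x + S\<^sub>n)\<close> on the event that the first \<open>n\<close> steps lie in \<open>K\<close>.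
\<close>

definition step :: "'a set \<Rightarrow> ('a \<Rightarrow> ennreal) \<Rightarrow> 'a \<Rightarrow> ennreal" where
  "step K g x = (\<integral>\<^sup>+ y. indicator K y * g (x + y) \<partial>\<mu>)"

abbreviation walk :: "'a set \<Rightarrow> nat \<Rightarrow> ('a \<Rightarrow> ennreal) \<Rightarrow> 'a \<Rightarrow> ennreal" where
  "walk K n \<equiv> step K ^^ n"

lemma translate_measurable [measurable]:
  assumes [measurable]: "g \<in> borel_measurable \<mu>"
  shows "(\<lambda>y. g (x + y)) \<in> borel_measurable \<mu>"
proof -
  have [measurable]: "(\<lambda>_. x) \<in> \<mu> \<rightarrow>\<^sub>M \<mu>" by (simp add: space_mu)
  show ?thesis by measurable
qed

lemma step_measurable [measurable]:
  assumes [measurable]: "g \<in> borel_measurable \<mu>" "K \<in> sets \<mu>"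
  shows "step K g \<in> borel_measurable \<mu>"
  unfolding step_def by measurable

lemma walk_measurable [measurable]:
  assumes [measurable]: "g \<in> borel_measurable \<mu>" "K \<in> sets \<mu>"
  shows "walk K n g \<in> borel_measurable \<mu>"
  by (induction n) auto

lemma step_mono:
  assumes "K \<subseteq> K'" "\<And>x. g x \<le> h x"
  shows "step K g x \<le> step K' h x"
  unfolding step_def using assms
  by (intro nn_integral_mono mult_mono) (auto simp: indicator_def)

lemma walk_mono:
  assumes "K \<subseteq> K'" "\<And>x. g x \<le> h x"
  shows "walk K n g x \<le> walk K' n h x"
  using assms(2)
  by (induction n arbitrary: x) (auto intro!: step_mono assms(1))

lemma walk_cmult:
  assumes [measurable]: "g \<in> borel_measurable \<mu>" "K \<in> sets \<mu>"
  shows "walk K n (\<lambda>x. c * g x) = (\<lambda>x. c * walk K n g x)"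
proof (induction n)
  case (Suc n)
  have "step K (\<lambda>x. c * walk K n g x) x = c * step K (walk K n g) x" for x
  proof -
    have "step K (\<lambda>x. c * walk K n g x) x = (\<integral>\<^sup>+ y. c * (indicator K y * walk K n g (x + y)) \<partial>\<mu>)"
      by (simp only: step_def[where x=x] mult.left_commute)
    also have "\<dots> = c * step K (walk K n g) x"
      unfolding step_def[where x=x] by (rule nn_integral_cmult) measurable
    finally show ?thesis .
  qed
  then show ?case by (simp add: Suc)
qed simp

lemma walk_sum:
  assumes "\<And>i. i \<in> I \<Longrightarrow> g i \<in> borel_measurable \<mu>" and [measurable]: "K \<in> sets \<mu>"
  shows "walk K n (\<lambda>x. \<Sum>i\<in>I. g i x) = (\<lambda>x. \<Sum>i\<in>I. walk K n (g i) x)"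
proof (induction n)
  case (Suc n)
  have "step K (\<lambda>x. \<Sum>i\<in>I. walk K n (g i) x) x = (\<Sum>i\<in>I. step K (walk K n (g i)) x)" for x
    unfolding step_def[where x=x] sum_distrib_left using assms
    by (intro nn_integral_sum borel_measurable_times translate_measurable walk_measurable) auto
  then show ?case by (simp add: Suc)
qed simp

text \<open>A multiplicative function is an eigenfunction of \<open>step K\<close>, the eigenvalue
  being its integral over \<open>K\<close>.\<close>

lemma walk_exp:
  assumes [measurable]: "g \<in> borel_measurable \<mu>" "K \<in> sets \<mu>"
    and "\<And>x y. g (x + y) = g x * g y"
  shows "walk K n g x = g x * (\<integral>\<^sup>+ y. indicator K y * g y \<partial>\<mu>) ^ n"
proof (induction n arbitrary: x)
  case (Suc n)
  define c where "c = (\<integral>\<^sup>+ y. indicator K y * g y \<partial>\<mu>)"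
  have "walk K (Suc n) g x = step K (walk K n g) x" by simp
  also have "\<dots> = (\<integral>\<^sup>+ y. (g x * c ^ n) * (indicator K y * g y) \<partial>\<mu>)"
    unfolding step_def Suc assms(3) c_def[symmetric] by (intro nn_integral_cong) (simp only: ac_simps)
  also have "\<dots> = (g x * c ^ n) * c"
    unfolding c_def by (rule nn_integral_cmult) measurable
  finally show ?case by (simp add: c_def ac_simps)
qed simp

lemma walk_translate_ge:
  assumes [measurable]: "h \<in> borel_measurable \<mu>" "K \<in> sets \<mu>"
    and "\<And>y. g (x + y) \<ge> c * h y"
  shows "walk K n g (x + y) \<ge> c * walk K n h y"
proof (induction n arbitrary: y)
  case (Suc n)
  have "c * walk K (Suc n) h y = (\<integral>\<^sup>+ z. indicator K z * (c * walk K n h (y + z)) \<partial>\<mu>)"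
    by (simp add: step_def mult.left_commute[of _ c] nn_integral_cmult)
  also have "\<dots> \<le> walk K (Suc n) g (x + y)"
    using Suc by (auto simp: step_def[where x="x + y"] add.assoc intro!: nn_integral_mono mult_left_mono)
  finally show ?case .
qed (use assms in simp)

text \<open>Independence of two blocks in operator form: the walk of \<open>n + m\<close> steps is a
  composition, and from the position \<open>x\<close> reached by the first \<open>n\<close> steps
  the last \<open>m\<close> contribute at least \<open>g x * walk K m h 0\<close>.\<close>

lemma walk_supermultiplicative:
  assumes [measurable]: "g \<in> borel_measurable \<mu>" "h \<in> borel_measurable \<mu>" "K \<in> sets \<mu>"
    and "\<And>x y. k (x + y) \<ge> g x * h y"
  shows "walk K (n + m) k 0 \<ge> walk K n g 0 * walk K m h 0"
proof -
  have "walk K m h 0 * g x \<le> walk K m k x" for x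
    using walk_translate_ge[of h K "g x" k x m 0] assms by (simp add: mult.commute)
  then have "walk K n (\<lambda>x. walk K m h 0 * g x) 0 \<le> walk K n (walk K m k) 0"
    by (intro walk_mono) auto
  then show ?thesis
    unfolding walk_cmult[OF assms(1,3)] by (simp add: funpow_add mult.commute[of "walk K n g 0"])
qed

text \<open>As \<open>D\<close> need not be measurable, being carried by \<open>D\<close> is
  exploited through measurable sets that miss \<open>D\<close>, compared with the empty set.\<close>

lemma carried_AE:
  assumes "carried_by \<mu> D" "A \<in> sets \<mu>" "A \<inter> D = {}"
  shows "AE y in \<mu>. y \<notin> A"
proof -
  have "emeasure \<mu> A = emeasure \<mu> {}" using assms unfolding carried_by_def by blast
  then show ?thesis using assms(2) by (intro AE_not_in) (auto simp: null_sets_def)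
qed

text \<open>\<open>E n\<close> is an invariant: it is preserved, with its index raised, by steps in
  \<open>K \<inter> D\<close>. The induction peels off the last step, turning a comparison on
  \<open>E (m + Suc n)\<close> into one of \<open>step K g\<close> with \<open>step K h\<close> on
  \<open>E (m + n)\<close>.\<close>

lemma walk_mono_on:
  assumes D: "carried_by \<mu> D"
    and [measurable]: "K \<in> sets \<mu>" "g \<in> borel_measurable \<mu>" "h \<in> borel_measurable \<mu>"
    and E: "\<And>n x y. x \<in> E n \<Longrightarrow> y \<in> K \<inter> D \<Longrightarrow> x + y \<in> E (Suc n)"
    and "\<And>z. z \<in> E (m + n) \<Longrightarrow> g z \<le> h z" and "x \<in> E m"
  shows "walk K n g x \<le> walk K n h x"
  using assms(3,4,6,7)
proof (induction n arbitrary: g h x)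
  case (Suc n)
  note [measurable] = Suc.prems(1,2)
  have "step K g z \<le> step K h z" if "z \<in> E (m + n)" for z
  proof -
    have "g (z + y) \<le> h (z + y)" if "y \<in> K \<inter> D" for y
      using E[OF \<open>z \<in> E (m + n)\<close> that] Suc.prems(3) by simp
    \<comment> \<open>The exceptional set is measurable and misses \<open>D\<close>: outside
      \<open>K\<close> both sides vanish, and on \<open>K \<inter> D\<close> the comparison
      holds.\<close>
    then have "AE y in \<mu>. y \<notin> {y \<in> space \<mu>. indicator K y * g (z + y) > indicator K y * h (z + y)}"
      by (intro carried_AE[OF D]) (auto simp: indicator_def not_less[symmetric] split: if_splits)
    then have "AE y in \<mu>. indicator K y * g (z + y) \<le> indicator K y * h (z + y)"
      by (simp add: space_mu not_less)
    then show ?thesis unfolding step_def by (rule nn_integral_mono_AE)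
  qed
  then have "walk K n (step K g) x \<le> walk K n (step K h) x"
    using Suc.prems(4) by (intro Suc.IH) auto
  then show ?case by (simp add: funpow_swap1)
qed simp

section \<open>Laws of the partial sums\<close>

text \<open>Built from \<open>\<mu>\<close> alone, so that the given sequence \<open>X\<close> can
  be eliminated. \<open>law 0\<close> is the point mass at 0, the law of an empty block.\<close>

definition law :: "nat \<Rightarrow> 'a measure" where
  "law n = distr (PiM {1..n} (\<lambda>_. \<mu>)) \<mu> (\<lambda>\<omega>. \<Sum>k=1..n. \<omega> k)"

lemma sum_coordinates_measurable [measurable]:
  "(\<lambda>\<omega>. \<Sum>k\<in>I. \<omega> k) \<in> PiM I (\<lambda>_. \<mu>) \<rightarrow>\<^sub>M \<mu>"
  by (rule measurable_sum) measurable

text \<open>Fubini integrates out the last coordinate first, which replaces \<open>g\<close> by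
  \<open>step UNIV g\<close> and shortens the sum; hence the induction over arbitrary
  \<open>g\<close>.\<close>

lemma nn_integral_walk:
  assumes "g \<in> borel_measurable \<mu>"
  shows "(\<integral>\<^sup>+ \<omega>. g (x + (\<Sum>k=1..n. \<omega> k)) \<partial>PiM {1..n} (\<lambda>_. \<mu>)) = walk UNIV n g x"
  using assms
proof (induction n arbitrary: g)
  case 0
  then show ?case by (simp add: PiM_empty)
next
  case (Suc n)
  note [measurable] = Suc.prems
  interpret product_sigma_finite "\<lambda>_::nat. \<mu>" by standard
  have [measurable]: "UNIV \<in> sets \<mu>" using sets.top[of \<mu>] by (simp add: space_mu)
  have [measurable]: "(\<lambda>_. x) \<in> N \<rightarrow>\<^sub>M \<mu>" for N :: "(nat \<Rightarrow> 'a) measure" by (simp add: space_mu)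
  have ins: "{1..Suc n} = insert (Suc n) {1..n}" by auto
  have "(\<integral>\<^sup>+ \<omega>. g (x + (\<Sum>k=1..Suc n. \<omega> k)) \<partial>PiM {1..Suc n} (\<lambda>_. \<mu>)) =
      (\<integral>\<^sup>+ \<omega>. (\<integral>\<^sup>+ y. g (x + (\<Sum>k\<in>insert (Suc n) {1..n}. fun_upd \<omega> (Suc n) y k)) \<partial>\<mu>) \<partial>PiM {1..n} (\<lambda>_. \<mu>))"
    unfolding ins by (rule product_nn_integral_insert) auto
  also have "\<dots> = (\<integral>\<^sup>+ \<omega>. (step UNIV g) (x + (\<Sum>k=1..n. \<omega> k)) \<partial>PiM {1..n} (\<lambda>_. \<mu>))"
    by (intro nn_integral_cong) (simp add: step_def add.commute add.left_commute)
  also have "\<dots> = walk UNIV (Suc n) g x"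
    by (subst Suc.IH) (auto simp: funpow_swap1)
  finally show ?case .
qed

lemma prob_space_law: "prob_space (law n)"
  unfolding law_def
  by (intro prob_space.prob_space_distr prob_space_PiM prob_space_axioms) measurable

lemma sets_law [simp, measurable_cong]: "sets (law n) = sets \<mu>"
  by (simp add: law_def)

lemma walk_UNIV_indicator:
  assumes [measurable]: "A \<in> sets \<mu>"
  shows "walk UNIV n (indicator A) 0 = emeasure (law n) A"
proof -
  have "emeasure (law n) A = (\<integral>\<^sup>+ z. indicator A z \<partial>law n)" by simp
  also have "\<dots> = (\<integral>\<^sup>+ \<omega>. indicator A (0 + (\<Sum>k=1..n. \<omega> k)) \<partial>PiM {1..n} (\<lambda>_. \<mu>))"
    unfolding law_def by (subst nn_integral_distr) auto
  also have "\<dots> = walk UNIV n (indicator A) 0" by (rule nn_integral_walk) measurable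
  finally show ?thesis ..
qed

text \<open>Independence and equal distribution identify the joint law of the first \<open>n\<close>
  variables with the product measure; the division by \<open>n\<close> is moved into the
  event.\<close>

lemma cramer_sequence_law:
  assumes X: "iid_sequence M \<mu> X" and n: "n \<ge> 1" and [measurable]: "B \<in> sets \<mu>"
  shows "emeasure (cramer_sequence M \<mu> X n) B = emeasure (law n) {z. (1 / real n) *\<^sub>R z \<in> B}"
proof -
  interpret M: prob_space M using X by (simp add: iid_sequence_def)
  have ind: "M.indep_vars (\<lambda>_. \<mu>) X {1..n}"
    using X by (auto simp: iid_sequence_def intro: M.indep_vars_subset)
  then have rv [measurable]: "X i \<in> M \<rightarrow>\<^sub>M \<mu>" if "i \<in> {1..n}" for i
    using that by (auto simp: M.indep_vars_def)
  have "distr M (PiM {1..n} (\<lambda>_. \<mu>)) (\<lambda>\<omega>. \<lambda>i\<in>{1..n}. X i \<omega>) = PiM {1..n} (\<lambda>i. distr M \<mu> (X i))"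
    using M.indep_vars_iff_distr_eq_PiM'[of "{1..n}" X "\<lambda>_. \<mu>"] ind rv n by auto
  also have "\<dots> = PiM {1..n} (\<lambda>_. \<mu>)"
    using X by (intro PiM_cong) (auto simp: iid_sequence_def)
  finally have law: "PiM {1..n} (\<lambda>_. \<mu>) =
      distr M (PiM {1..n} (\<lambda>_. \<mu>)) (\<lambda>\<omega>. \<lambda>i\<in>{1..n}. X i \<omega>)" ..
  have sc: "(*\<^sub>R) (1 / real n) \<in> \<mu> \<rightarrow>\<^sub>M \<mu>"
    using measurable_scaleR[of "\<lambda>x. x" \<mu> "1 / real n"] n by simp
  have m1: "(\<lambda>\<omega>. \<lambda>i\<in>{1..n}. X i \<omega>) \<in> M \<rightarrow>\<^sub>M PiM {1..n} (\<lambda>_. \<mu>)"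
    by (rule measurable_restrict) (rule rv)
  have S: "(\<lambda>\<omega>. \<Sum>k=1..n. X k \<omega>) \<in> M \<rightarrow>\<^sub>M \<mu>" by (rule measurable_sum) (rule rv)
  have "law n = distr M \<mu> (\<lambda>\<omega>. \<Sum>k=1..n. X k \<omega>)"
    unfolding law_def
    by (subst law, subst distr_distr[OF _ m1]) (auto simp: comp_def intro!: distr_cong)
  moreover have "cramer_sequence M \<mu> X n = distr (distr M \<mu> (\<lambda>\<omega>. \<Sum>k=1..n. X k \<omega>)) \<mu> ((*\<^sub>R) (1 / real n))"
    unfolding cramer_sequence_def by (subst distr_distr[OF sc S]) (simp add: comp_def)
  ultimately have "cramer_sequence M \<mu> X n = distr (law n) \<mu> ((*\<^sub>R) (1 / real n))" by simp
  then show ?thesis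
    using sc by (simp add: emeasure_distr vimage_def space_mu law_def)
qed

section \<open>Probabilities of cells\<close>

lemma cell_sets [measurable]:
  assumes "C \<in> \<C>\<^sub>0" "0 < t"
  shows "cell C c t \<in> sets \<mu>"
  using scaled_translate_sets[OF assms(1), of t c] assms(2) by (simp add: cell_def sets_mu)

text \<open>Convexity gives the pointwise inequality between indicators that supermultiplicativity
  of the walk asks for.\<close>

lemma law_cell_add:
  assumes C: "C \<in> \<C>\<^sub>0" and st: "0 < s" "0 < t"
  shows "emeasure (law n) (cell C c s) * emeasure (law m) (cell C d t)
    \<le> emeasure (law (n + m)) (cell C (c + d) (s + t))"
proof -
  have "indicator (cell C c s) x * indicator (cell C d t) y
      \<le> (indicator (cell C (c + d) (s + t)) (x + y) :: ennreal)" for x y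
    using convex_cone_add[OF convex[OF C], of s t "x - c" "y - d"] st
    by (auto simp: cell_def indicator_def add_diff_add)
  then show ?thesis
    using st sets.top[of \<mu>] cell_sets[OF C]
    by (subst (1 2 3) walk_UNIV_indicator[symmetric])
      (auto intro!: walk_supermultiplicative simp: space_mu)
qed

lemma law_cell_power:
  assumes C: "C \<in> \<C>\<^sub>0" and "0 < t" "k \<ge> 1"
  shows "emeasure (law n) (cell C c t) ^ k \<le> emeasure (law (k * n)) (cell C (real k *\<^sub>R c) (real k * t))"
  using assms(3)
proof (induction k rule: dec_induct)
  case (step k)
  have "emeasure (law n) (cell C c t) ^ Suc k
      \<le> emeasure (law n) (cell C c t) * emeasure (law (k * n)) (cell C (real k *\<^sub>R c) (real k * t))"
    using step by (auto intro: mult_left_mono)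
  also have "\<dots> \<le> emeasure (law (n + k * n)) (cell C (c + real k *\<^sub>R c) (t + real k * t))"
    using step assms by (intro law_cell_add) auto
  finally show ?case by (simp add: algebra_simps)
qed simp

text \<open>\<open>C\<close> is absorbing, so cells of growing radius exhaust the space and
  continuity from below applies. The value 1/2 is an arbitrary constant strictly between 0 and
  1.\<close>

lemma law_cell_ge_half:
  assumes C: "C \<in> \<C>\<^sub>0"
  shows "\<forall>\<^sub>F t in at_top. emeasure (law n) (cell C c t) \<ge> ennreal (1 / 2)"
proof -
  interpret L: prob_space "law n" by (rule prob_space_law)
  have "(\<Union>k. cell C c (real (Suc k))) = UNIV"
  proof (intro equalityI subsetI)
    fix z :: 'a
    obtain t where t: "t > 0" "z \<in> cell C c t" using absorbing[OF C, of "z - c"] by (auto simp: cell_def)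
    obtain k where "t \<le> real k" using real_arch_simple by blast
    then show "z \<in> (\<Union>k. cell C c (real (Suc k)))" using t cell_mono[OF C, of t "real (Suc k)" c] by auto
  qed simp
  moreover have "(\<lambda>k. emeasure (law n) (cell C c (real (Suc k))))
      \<longlonglongrightarrow> emeasure (law n) (\<Union>k. cell C c (real (Suc k)))"
    by (intro Lim_emeasure_incseq incseq_SucI cell_mono[OF C]) (auto simp: cell_sets[OF C])
  moreover have "emeasure (law n) UNIV = 1"
    using L.emeasure_space_1 by (simp add: law_def space_mu)
  ultimately have "(\<lambda>k. emeasure (law n) (cell C c (real (Suc k)))) \<longlonglongrightarrow> 1" by simp
  then have "\<forall>\<^sub>F k in sequentially. ennreal (1 / 2) < emeasure (law n) (cell C c (real (Suc k)))"
    by (rule order_tendstoD) (subst ennreal_less_one_iff, simp)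
  then obtain k where k: "ennreal (1 / 2) < emeasure (law n) (cell C c (real (Suc k)))"
    by (meson eventually_sequentially order_refl)
  have "ennreal (1 / 2) \<le> emeasure (law n) (cell C c t)" if "t \<ge> real (Suc k)" for t
  proof -
    have "emeasure (law n) (cell C c (real (Suc k))) \<le> emeasure (law n) (cell C c t)"
      using that by (intro emeasure_mono cell_mono[OF C]) (auto simp: cell_sets[OF C])
    then show ?thesis using k by simp
  qed
  then show ?thesis unfolding eventually_at_top_linorder by blast
qed

text \<open>
  Writing \<open>m = k n + r\<close> with \<open>r < n\<close>, the sum of the first \<open>k\<close> blocks is controlled by
  supermultiplicativity, and the half of the cell that is left over absorbs the remaining
  \<open>r\<close> summands.
\<close>
lemma liminf_law_cell:
  assumes C: "C \<in> \<C>\<^sub>0" and n: "n \<ge> 1"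
    and large: "emeasure (law n) (cell C (real n *\<^sub>R x) (real n / 2)) > ennreal (exp (real n * b))"
  shows "liminf (\<lambda>m. ereal (1 / real m) * ext_log (emeasure (law m) (cell C (real m *\<^sub>R x) (real m)))) \<ge> ereal b"
proof -
  \<comment> \<open>The term \<open>\<bar>b\<bar> * real n\<close> pays for the fewer than
    \<open>n\<close> leftover summands whatever the sign of \<open>b\<close>, and
    \<open>ln 2\<close> for the probability 1/2 of their cell. Both disappear after division by
    \<open>m\<close>.\<close>
  define g where "g m = (b * real m - (\<bar>b\<bar> * real n + ln 2)) / real m" for m
  \<comment> \<open>Only finitely many remainders occur, so one threshold serves all of
    them.\<close>
  have "\<forall>\<^sub>F t in at_top. \<forall>r\<in>{..<n}. emeasure (law r) (cell C (real r *\<^sub>R x) t) \<ge> ennreal (1 / 2)"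
    by (intro eventually_ball_finite ballI law_cell_ge_half C) simp
  then obtain t0 where t0: "\<And>t r. t \<ge> t0 \<Longrightarrow> r < n \<Longrightarrow> emeasure (law r) (cell C (real r *\<^sub>R x) t) \<ge> ennreal (1 / 2)"
    unfolding eventually_at_top_linorder by auto
  have bound: "ereal (g m) \<le> ereal (1 / real m) * ext_log (emeasure (law m) (cell C (real m *\<^sub>R x) (real m)))"
    if m: "m \<ge> n" "real m / 2 \<ge> t0" for m
  proof -
    define k where "k = m div n"
    define r where "r = m mod n"
    have m_eq: "m = k * n + r" by (simp add: k_def r_def)
    have r: "r < n" using n by (simp add: r_def)
    have k: "k \<ge> 1" using m n by (simp add: k_def Suc_leI div_greater_zero_iff)
    have mr: "real m = real k * real n + real r" by (simp add: m_eq)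
    have "b * real m - \<bar>b\<bar> * real n \<le> b * (real k * real n)"
    proof -
      have "b * real r \<le> \<bar>b\<bar> * real n" using r by (intro mult_mono) auto
      then show ?thesis by (simp add: mr algebra_simps)
    qed
    then have "exp (b * real m - \<bar>b\<bar> * real n) / 2 \<le> exp (b * (real k * real n)) * (1 / 2)" by simp
    also have "exp (b * real m - \<bar>b\<bar> * real n) / 2 = exp (b * real m - (\<bar>b\<bar> * real n + ln 2))"
      by (simp add: exp_diff exp_add)
    also have "exp (b * (real k * real n)) = exp (real n * b) ^ k"
    proof -
      have "b * (real k * real n) = real k * (real n * b)" by simp
      then show ?thesis by (simp only: exp_of_nat_mult)
    qed
    finally have "exp (b * real m - (\<bar>b\<bar> * real n + ln 2)) \<le> exp (real n * b) ^ k * (1 / 2)" .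
    then have "ennreal (exp (b * real m - (\<bar>b\<bar> * real n + ln 2))) \<le> ennreal (exp (real n * b) ^ k * (1 / 2))"
      by (rule ennreal_leI)
    also have "\<dots> = ennreal (exp (real n * b)) ^ k * ennreal (1 / 2)"
      by (simp only: ennreal_power exp_ge_zero, rule ennreal_mult) auto
    also have "\<dots> \<le> emeasure (law n) (cell C (real n *\<^sub>R x) (real n / 2)) ^ k
        * emeasure (law r) (cell C (real r *\<^sub>R x) (real m / 2))"
      using large t0[OF m(2) r] by (intro mult_mono power_mono) auto
    also have "\<dots> \<le> emeasure (law (k * n)) (cell C (real k *\<^sub>R (real n *\<^sub>R x)) (real k * (real n / 2)))
        * emeasure (law r) (cell C (real r *\<^sub>R x) (real m / 2))"
      using n k by (intro mult_right_mono law_cell_power C) auto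
    also have "\<dots> \<le> emeasure (law (k * n + r))
        (cell C (real k *\<^sub>R (real n *\<^sub>R x) + real r *\<^sub>R x) (real k * (real n / 2) + real m / 2))"
      using n k m by (intro law_cell_add C) auto
    also have "real k *\<^sub>R (real n *\<^sub>R x) + real r *\<^sub>R x = real m *\<^sub>R x"
      by (simp add: mr scaleR_left_distrib)
    also have "emeasure (law (k * n + r)) (cell C (real m *\<^sub>R x) (real k * (real n / 2) + real m / 2))
        \<le> emeasure (law m) (cell C (real m *\<^sub>R x) (real m))"
      unfolding m_eq[symmetric]
    proof (intro emeasure_mono)
      show "cell C (real m *\<^sub>R x) (real k * (real n / 2) + real m / 2) \<subseteq> cell C (real m *\<^sub>R x) (real m)"
      proof (rule cell_mono[OF C])
        have "real k * (real n / 2) \<le> real m / 2" by (simp add: mr)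
        then show "real k * (real n / 2) + real m / 2 \<le> real m" by simp
      qed simp
      show "cell C (real m *\<^sub>R x) (real m) \<in> sets (law m)" using m n cell_sets[OF C] by simp
    qed
    finally have "ereal (b * real m - (\<bar>b\<bar> * real n + ln 2))
        \<le> ext_log (emeasure (law m) (cell C (real m *\<^sub>R x) (real m)))"
      unfolding ext_log_exp[symmetric] by (rule ext_log_mono)
    then have "ereal (1 / real m) * ereal (b * real m - (\<bar>b\<bar> * real n + ln 2))
        \<le> ereal (1 / real m) * ext_log (emeasure (law m) (cell C (real m *\<^sub>R x) (real m)))"
      by (intro ereal_mult_left_mono) auto
    then show ?thesis by (simp add: g_def)
  qed
  have "g \<longlonglongrightarrow> b" unfolding g_def by real_asymp
  then have "liminf (\<lambda>m. ereal (g m)) = ereal b" by (intro lim_imp_Liminf) auto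
  moreover have "\<forall>\<^sub>F m in sequentially. ereal (g m) \<le> ereal (1 / real m) * ext_log (emeasure (law m) (cell C (real m *\<^sub>R x) (real m)))"
    using eventually_ge_at_top[of n] eventually_ge_at_top[of "nat \<lceil>2 * t0\<rceil>"]
    by eventually_elim (rule bound, simp, linarith)
  then have "liminf (\<lambda>m. ereal (g m)) \<le> liminf (\<lambda>m. ereal (1 / real m) * ext_log (emeasure (law m) (cell C (real m *\<^sub>R x) (real m))))"
    by (rule Liminf_mono)
  ultimately show ?thesis by simp
qed

text \<open>A single \<open>n\<close> violating the bound would already force the lower limit up to
  \<open>b\<close>. This makes an asymptotic bound uniform in \<open>n\<close>, at the price of
  halving the radius.\<close>

lemma law_cell_le_exp:
  assumes C: "C \<in> \<C>\<^sub>0" and n: "n \<ge> 1"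
    and "liminf (\<lambda>m. ereal (1 / real m) * ext_log (emeasure (law m) (cell C (real m *\<^sub>R x) (real m)))) < ereal b"
  shows "emeasure (law n) (cell C (real n *\<^sub>R x) (real n / 2)) \<le> ennreal (exp (real n * b))"
  using liminf_law_cell[OF C n, of b x] assms(3) by (meson not_le)

section \<open>Entropy and pressure\<close>

lemma entropy_eq:
  assumes "iid_sequence M \<mu> X"
  shows "Defs.entropy \<C>\<^sub>0 (cramer_sequence M \<mu> X) x =
    (INF C\<in>\<C>\<^sub>0. liminf (\<lambda>n. ereal (1 / real n) * ext_log (emeasure (law n) (cell C (real n *\<^sub>R x) (real n)))))"
  unfolding Defs.entropy_def translates_def image_image
proof (intro INF_cong refl Liminf_eq)
  fix C assume C: "C \<in> \<C>\<^sub>0"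
  show "\<forall>\<^sub>F n in sequentially. ereal (1 / real n) * ext_log (emeasure (cramer_sequence M \<mu> X n) ((+) x ` C)) =
      ereal (1 / real n) * ext_log (emeasure (law n) (cell C (real n *\<^sub>R x) (real n)))"
    using eventually_ge_at_top[of 1]
  proof eventually_elim
    case (elim n)
    then show ?case
      using cramer_sequence_law[OF assms elim] translate_sets[OF C] translate_eq_cell[of "real n" x C]
      by (simp add: sets_mu)
  qed
qed

lemma exp_dual_measurable:
  assumes "f \<in> topological_dual \<tau>"
  shows "(\<lambda>z. ennreal (exp (f z))) \<in> borel_measurable \<mu>"
  using dual_measurable[OF assms] by measurable

lemma walk_exp_dual:
  assumes "f \<in> topological_dual \<tau>" "K \<in> sets \<mu>"
  shows "walk K n (\<lambda>z. ennreal (exp (f z))) 0 = (\<integral>\<^sup>+ y. indicator K y * ennreal (exp (f y)) \<partial>\<mu>) ^ n"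
proof -
  have lin: "linear f" using assms(1) by (simp add: topological_dual_def)
  show ?thesis
    by (subst walk_exp[OF exp_dual_measurable[OF assms(1)] assms(2)])
      (auto simp: linear_add[OF lin] linear_0[OF lin] exp_add ennreal_mult)
qed

lemma dual_cell_le:
  assumes "linear f" "\<And>z. z \<in> C \<Longrightarrow> \<bar>f z\<bar> < e" "0 \<le> t" "z \<in> cell C c t"
  shows "\<bar>f z - f c\<bar> \<le> t * e"
proof -
  obtain w where w: "w \<in> C" "z - c = t *\<^sub>R w" using assms(4) by (auto simp: cell_def)
  have "f z - f c = t * f w"
    by (metis linear_diff[OF assms(1)] linear_cmul[OF assms(1)] w(2) real_scaleR_def)
  then show ?thesis
    using assms(2)[OF w(1)] assms(3) by (simp add: abs_mult mult_left_mono)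
qed

text \<open>On the cell of radius \<open>n\<close>, \<open>f\<close> is at least
  \<open>n (f x - e)\<close>, so Markov's inequality bounds its probability by
  \<open>exp (n (p - f x + e))\<close> for every \<open>n \<ge> 1\<close>; then \<open>e\<close>
  tends to 0.\<close>

lemma dual_plus_entropy_le:
  assumes f: "f \<in> topological_dual \<tau>" and X: "iid_sequence M \<mu> X"
  shows "ereal (f x) + Defs.entropy \<C>\<^sub>0 (cramer_sequence M \<mu> X) x \<le> ext_log (\<integral>\<^sup>+ y. ennreal (exp (f y)) \<partial>\<mu>)"
proof -
  note [measurable] = dual_measurable[OF f]
  have lin: "linear f" using f by (simp add: topological_dual_def)
  define c where "c = (\<integral>\<^sup>+ y. ennreal (exp (f y)) \<partial>\<mu>)"
  \<comment> \<open>Needed for the logarithm to be a real number \<open>p\<close> when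
    \<open>c\<close> is finite.\<close>
  have "c \<noteq> 0"
  proof
    assume "c = 0"
    then have "AE y in \<mu>. False"
      using nn_integral_0_iff_AE[OF exp_dual_measurable[OF f]] by (simp add: c_def)
    then show False using AE_False by (simp add: not_empty)
  qed
  show ?thesis
  proof (cases "c = \<infinity>")
    case True
    then show ?thesis by (simp add: c_def[symmetric] ext_log_def)
  next
    case False
    then obtain q where q: "c = ennreal q" "0 \<le> q" by (cases c) auto
    with \<open>c \<noteq> 0\<close> have "q > 0" by (cases "q = 0") auto
    define p where "p = ln q"
    have c: "c = ennreal (exp p)" using q \<open>q > 0\<close> by (simp add: p_def)
    have "ereal (f x) + Defs.entropy \<C>\<^sub>0 (cramer_sequence M \<mu> X) x \<le> ereal p + ereal e" if e: "e > 0" for e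
    proof -
      obtain C where C: "C \<in> \<C>\<^sub>0" "\<And>z. z \<in> C \<Longrightarrow> \<bar>f z\<bar> < e" using dual_small[OF f e] by blast
      define l where "l n = emeasure (law n) (cell C (real n *\<^sub>R x) (real n))" for n
      have le: "ereal (1 / real n) * ext_log (l n) \<le> ereal (p - f x + e)" if n: "n \<ge> 1" for n
      proof -
        have U: "UNIV \<in> sets \<mu>" using sets.top[of \<mu>] by (simp add: space_mu)
        have cs: "cell C (real n *\<^sub>R x) (real n) \<in> sets \<mu>" using n by (intro cell_sets C) simp
        have "indicator (cell C (real n *\<^sub>R x) (real n)) z
            \<le> ennreal (exp (- real n * (f x - e))) * ennreal (exp (f z))" for z
        proof (cases "z \<in> cell C (real n *\<^sub>R x) (real n)")
          case True
          then have "0 \<le> - real n * (f x - e) + f z"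
            using dual_cell_le[OF lin C(2) _ True]
            by (simp add: linear_cmul[OF lin] algebra_simps)
          then show ?thesis using True
            by (simp only: ennreal_mult[symmetric] exp_ge_zero exp_add[symmetric]) simp
        qed simp
        then have "walk UNIV n (indicator (cell C (real n *\<^sub>R x) (real n))) 0
            \<le> walk UNIV n (\<lambda>z. ennreal (exp (- real n * (f x - e))) * ennreal (exp (f z))) 0"
          by (intro walk_mono) auto
        also have "\<dots> = ennreal (exp (- real n * (f x - e))) * c ^ n"
          using walk_exp_dual[OF f U] unfolding walk_cmult[OF exp_dual_measurable[OF f] U] by (simp add: c_def)
        also have "\<dots> = ennreal (exp (real n * (p - f x + e)))"
          by (simp add: c ennreal_power exp_of_nat_mult[symmetric] ennreal_mult[symmetric]
              exp_add[symmetric] algebra_simps)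
        finally have "l n \<le> ennreal (exp (real n * (p - f x + e)))"
          by (simp add: l_def walk_UNIV_indicator[OF cs])
        then have "ext_log (l n) \<le> ereal (real n * (p - f x + e))"
          by (metis ext_log_exp ext_log_mono)
        then have "ereal (1 / real n) * ext_log (l n) \<le> ereal (1 / real n) * ereal (real n * (p - f x + e))"
          by (intro ereal_mult_left_mono) auto
        then show ?thesis using n by simp
      qed
      have "Defs.entropy \<C>\<^sub>0 (cramer_sequence M \<mu> X) x \<le> liminf (\<lambda>n. ereal (1 / real n) * ext_log (l n))"
        unfolding entropy_eq[OF X] l_def using C(1) by (rule INF_lower)
      also have "\<dots> \<le> limsup (\<lambda>n. ereal (1 / real n) * ext_log (l n))"
        by (rule Liminf_le_Limsup) simp
      also have "\<dots> \<le> ereal (p - f x + e)"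
        using le by (intro Limsup_bounded eventually_sequentiallyI[of 1]) auto
      finally have "ereal (f x) + Defs.entropy \<C>\<^sub>0 (cramer_sequence M \<mu> X) x \<le> ereal (f x) + ereal (p - f x + e)"
        by (rule add_left_mono)
      then show ?thesis by simp
    qed
    then have "ereal (f x) + Defs.entropy \<C>\<^sub>0 (cramer_sequence M \<mu> X) x \<le> ereal p"
      by (rule ereal_le_epsilon2)
    then show ?thesis by (simp add: c_def[symmetric] c ext_log_exp)
  qed
qed

section \<open>Upper bound for the pressure\<close>

text \<open>\<open>C1\<close> gives probability at most \<open>exp (n (b - f x))\<close>, and on
  cells of \<open>C2\<close> the function \<open>f\<close> exceeds \<open>n f x\<close> by at most
  \<open>n (a - b)\<close>; on the intersection the two exponents add up to \<open>n a\<close>. The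
  same neighbourhood serves every \<open>n\<close>.\<close>

lemma exists_small_cell:
  assumes f: "f \<in> topological_dual \<tau>" and X: "iid_sequence M \<mu> X" and K: "K \<in> sets \<mu>"
    and less: "ereal (f x) + Defs.entropy \<C>\<^sub>0 (cramer_sequence M \<mu> X) x < ereal b" and "b < a"
  shows "\<exists>C\<in>\<C>\<^sub>0. \<forall>n\<ge>1. walk K n
    (\<lambda>z. ennreal (exp (f z)) * indicator (cell C (real n *\<^sub>R x) (real n / 2)) z) 0 \<le> ennreal (exp (real n * a))"
proof -
  have lin: "linear f" using f by (simp add: topological_dual_def)
  have U: "UNIV \<in> sets \<mu>" using sets.top[of \<mu>] by (simp add: space_mu)
  have "Defs.entropy \<C>\<^sub>0 (cramer_sequence M \<mu> X) x < ereal (b - f x)"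
    using less by (cases "Defs.entropy \<C>\<^sub>0 (cramer_sequence M \<mu> X) x") auto
  then obtain C1 where C1: "C1 \<in> \<C>\<^sub>0"
    "liminf (\<lambda>m. ereal (1 / real m) * ext_log (emeasure (law m) (cell C1 (real m *\<^sub>R x) (real m)))) < ereal (b - f x)"
    unfolding entropy_eq[OF X] INF_less_iff by blast
  obtain C2 where C2: "C2 \<in> \<C>\<^sub>0" "\<And>z. z \<in> C2 \<Longrightarrow> \<bar>f z\<bar> < a - b"
    using dual_small[OF f, of "a - b"] \<open>b < a\<close> by auto
  have "walk K n (\<lambda>z. ennreal (exp (f z)) * indicator (cell (C1 \<inter> C2) (real n *\<^sub>R x) (real n / 2)) z) 0
      \<le> ennreal (exp (real n * a))" if n: "n \<ge> 1" for n
  proof -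
    have cs: "cell C1 (real n *\<^sub>R x) (real n / 2) \<in> sets \<mu>" using n by (intro cell_sets C1) simp
    have "ennreal (exp (f z)) * indicator (cell (C1 \<inter> C2) (real n *\<^sub>R x) (real n / 2)) z
        \<le> ennreal (exp (real n * (f x + a - b))) * indicator (cell C1 (real n *\<^sub>R x) (real n / 2)) z" for z
    proof (cases "z \<in> cell (C1 \<inter> C2) (real n *\<^sub>R x) (real n / 2)")
      case True
      then have z: "z \<in> cell C1 (real n *\<^sub>R x) (real n / 2)" "z \<in> cell C2 (real n *\<^sub>R x) (real n / 2)"
        by (auto simp: cell_def)
      have "\<bar>f z - real n * f x\<bar> \<le> real n / 2 * (a - b)"
        using dual_cell_le[OF lin C2(2) _ z(2)] by (simp add: linear_cmul[OF lin])
      then have "f z - real n * f x \<le> real n / 2 * (a - b)" by (rule abs_le_D1)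
      also have "\<dots> \<le> real n * (a - b)" using \<open>b < a\<close> by simp
      finally have "f z \<le> real n * (f x + a - b)" by (simp add: algebra_simps)
      then show ?thesis using z True by (simp add: ennreal_leI)
    qed simp
    then have "walk K n (\<lambda>z. ennreal (exp (f z)) * indicator (cell (C1 \<inter> C2) (real n *\<^sub>R x) (real n / 2)) z) 0
        \<le> walk UNIV n (\<lambda>z. ennreal (exp (real n * (f x + a - b))) * indicator (cell C1 (real n *\<^sub>R x) (real n / 2)) z) 0"
      by (intro walk_mono) auto
    also have "\<dots> = ennreal (exp (real n * (f x + a - b))) * emeasure (law n) (cell C1 (real n *\<^sub>R x) (real n / 2))"
      using cs by (simp add: walk_cmult[OF _ U] walk_UNIV_indicator)
    also have "\<dots> \<le> ennreal (exp (real n * (f x + a - b))) * ennreal (exp (real n * (b - f x)))"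
      by (intro mult_left_mono law_cell_le_exp C1 n) simp
    also have "\<dots> = ennreal (exp (real n * a))"
      by (simp add: ennreal_mult[symmetric] exp_add[symmetric] algebra_simps)
    finally show ?thesis .
  qed
  then show ?thesis using Int_closed[OF C1(1) C2(1)] by blast
qed

lemma nn_integral_exp_le_on_convex_compact:
  assumes f: "f \<in> topological_dual \<tau>" and X: "iid_sequence M \<mu> X" and D: "carried_by \<mu> D"
    and K [measurable]: "K \<in> sets \<mu>" and conv: "convex (K \<inter> D)"
    and L: "compactin \<tau> L" "K \<inter> D \<subseteq> L"
    and less: "\<And>x. ereal (f x) + Defs.entropy \<C>\<^sub>0 (cramer_sequence M \<mu> X) x < ereal b" and "b < a"
  shows "(\<integral>\<^sup>+ y. indicator K y * ennreal (exp (f y)) \<partial>\<mu>) \<le> ennreal (exp a)"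
proof -
  note [measurable] = dual_measurable[OF f]
  obtain C where C: "\<And>x. C x \<in> \<C>\<^sub>0" "\<And>x n. n \<ge> 1 \<Longrightarrow> walk K n
      (\<lambda>z. ennreal (exp (f z)) * indicator (cell (C x) (real n *\<^sub>R x) (real n / 2)) z) 0 \<le> ennreal (exp (real n * a))"
    using exists_small_cell[OF f X K less \<open>b < a\<close>] by metis
  have cell_half: "cell (C x) x (1 / 2) = (+) x ` (*\<^sub>R) (1 / 2) ` C x" for x
    by (auto simp: cell_def translate_image_iff)
  have "openin \<tau> U" if "U \<in> range (\<lambda>x. cell (C x) x (1 / 2))" for U
    using that openin_translate[OF dilation_closed[OF C(1), of "1 / 2"]] by (auto simp: cell_half)
  moreover have "x \<in> cell (C x) x (1 / 2)" for x
    using zero_mem[OF C(1)] by (auto simp: cell_def)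
  ultimately have "\<exists>\<G>. finite \<G> \<and> \<G> \<subseteq> range (\<lambda>x. cell (C x) x (1 / 2)) \<and> L \<subseteq> \<Union>\<G>"
    using L(1) by (intro compactinD) blast+
  then obtain \<G> where \<G>: "finite \<G>" "\<G> \<subseteq> range (\<lambda>x. cell (C x) x (1 / 2))" "L \<subseteq> \<Union>\<G>" by blast
  then obtain I where I: "finite I" "L \<subseteq> (\<Union>x\<in>I. cell (C x) x (1 / 2))"
    using finite_subset_image[OF \<G>(1,2)] by blast
  \<comment> \<open>By convexity, sums of \<open>n\<close> steps in \<open>K \<inter> D\<close> lie
    in the \<open>n\<close>-fold dilate. The start is set apart because \<open>K \<inter> D\<close>
    may be empty while the walk begins at 0.\<close>
  define E where "E n = (if n = 0 then {0} else (*\<^sub>R) (real n) ` (K \<inter> D))" for n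
  have E: "x + y \<in> E (Suc n)" if "x \<in> E n" "y \<in> K \<inter> D" for n x y
  proof (cases "n = 0")
    case False
    then have "x + y \<in> (*\<^sub>R) (real n + 1) ` (K \<inter> D)"
      using that by (intro convex_cone_add[OF conv]) (auto simp: E_def)
    then show ?thesis by (simp add: E_def add.commute)
  qed (use that in \<open>auto simp: E_def\<close>)
  have "(\<integral>\<^sup>+ y. indicator K y * ennreal (exp (f y)) \<partial>\<mu>) ^ n \<le> of_nat (card I) * ennreal (exp (real n * a))"
    if n: "n \<ge> 1" for n
  proof -
    let ?g = "\<lambda>x z. ennreal (exp (f z)) * indicator (cell (C x) (real n *\<^sub>R x) (real n / 2)) z"
    have [measurable]: "cell (C x) (real n *\<^sub>R x) (real n / 2) \<in> sets \<mu>" for x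
      using n by (intro cell_sets C) simp
    \<comment> \<open>Dilation by \<open>n\<close> carries the cover of \<open>K \<inter> D\<close>
      to a cover of \<open>E n\<close> by as many cells, so the number of terms does not depend on
      \<open>n\<close>.\<close>
    have sum_ge: "ennreal (exp (f z)) \<le> (\<Sum>x\<in>I. ?g x z)" if z: "z \<in> E (0 + n)" for z
    proof -
      obtain w where w: "w \<in> K \<inter> D" "z = real n *\<^sub>R w" using z n by (auto simp: E_def)
      then obtain x where x: "x \<in> I" "w \<in> cell (C x) x (1 / 2)" using I(2) L(2) by blast
      then obtain c where c: "c \<in> C x" "w - x = (1 / 2) *\<^sub>R c" by (auto simp: cell_def)
      have "z - real n *\<^sub>R x = (real n / 2) *\<^sub>R c"
        using c(2) by (simp add: w(2) scaleR_diff_right[symmetric])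
      then have "z \<in> cell (C x) (real n *\<^sub>R x) (real n / 2)" using c(1) by (auto simp: cell_def)
      then have "?g x z = ennreal (exp (f z))" by simp
      then show ?thesis
        using member_le_sum[of x I "\<lambda>x. ?g x z"] x(1) I(1) by simp
    qed
    have "walk K n (\<lambda>z. ennreal (exp (f z))) 0 \<le> walk K n (\<lambda>z. \<Sum>x\<in>I. ?g x z) 0"
    proof (rule walk_mono_on[where D = D and E = E and m = 0, OF D K _ _ E sum_ge])
      show "0 \<in> E 0" by (simp add: E_def)
    qed measurable
    also have "\<dots> = (\<Sum>x\<in>I. walk K n (?g x) 0)"
      by (subst walk_sum) auto
    also have "\<dots> \<le> (\<Sum>x\<in>I. ennreal (exp (real n * a)))"
      using C(2) n by (intro sum_mono) auto
    finally show ?thesis by (simp add: walk_exp_dual[OF f K])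
  qed
  then show ?thesis by (rule le_exp_if_powers_le)
qed

end

text \<open>The sets \<open>K m\<close> are not assumed to increase, so monotone convergence is
  applied to truncations of \<open>g\<close> instead: truncated at \<open>N\<close>, the part
  outside \<open>K m\<close> contributes at most \<open>N (1 - prob (K m))\<close>, which tends to
  0.\<close>

lemma (in prob_space) nn_integral_le_if_exhausted:
  assumes [measurable]: "g \<in> borel_measurable M" and K: "\<And>m. m \<ge> 1 \<Longrightarrow> K m \<in> sets M"
    and lim: "(\<lambda>m. prob (K m)) \<longlonglongrightarrow> 1"
    and le: "\<And>m. m \<ge> 1 \<Longrightarrow> (\<integral>\<^sup>+ y. indicator (K m) y * g y \<partial>M) \<le> B"
  shows "(\<integral>\<^sup>+ y. g y \<partial>M) \<le> B"
proof -
  have le_N: "(\<integral>\<^sup>+ y. inf (g y) (of_nat N) \<partial>M) \<le> B" for N :: nat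
  proof -
    have "(\<integral>\<^sup>+ y. inf (g y) (of_nat N) \<partial>M) \<le> B + ennreal (real N * (1 - prob (K m)))" if m: "m \<ge> 1" for m
    proof -
      note [measurable] = K[OF m]
      have "(\<integral>\<^sup>+ y. inf (g y) (of_nat N) \<partial>M)
          \<le> (\<integral>\<^sup>+ y. indicator (K m) y * g y + of_nat N * indicator (space M - K m) y \<partial>M)"
        by (intro nn_integral_mono) (auto simp: indicator_def)
      also have "\<dots> = (\<integral>\<^sup>+ y. indicator (K m) y * g y \<partial>M) + of_nat N * emeasure M (space M - K m)"
        by (subst nn_integral_add) (auto simp: nn_integral_cmult)
      also have "of_nat N * emeasure M (space M - K m) = ennreal (real N * (1 - prob (K m)))"
        by (simp add: emeasure_eq_measure prob_compl ennreal_mult ennreal_of_nat_eq_real_of_nat)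
      finally show ?thesis using le[OF m] by (meson add_right_mono order_trans)
    qed
    moreover have "(\<lambda>m. B + ennreal (real N * (1 - prob (K m)))) \<longlonglongrightarrow> B + ennreal (real N * (1 - 1))"
      by (intro tendsto_intros lim tendsto_ennrealI)
    ultimately show ?thesis
      by (intro LIMSEQ_le_const[of "\<lambda>m. B + ennreal (real N * (1 - prob (K m)))"]) auto
  qed
  have "g y = (SUP N. inf (g y) (of_nat N))" for y
    by (simp add: inf_SUP[symmetric] ennreal_SUP_of_nat_eq_top)
  then have "(\<integral>\<^sup>+ y. g y \<partial>M) = (\<integral>\<^sup>+ y. (SUP N. inf (g y) (of_nat N)) \<partial>M)" by simp
  also have "\<dots> = (SUP N. \<integral>\<^sup>+ y. inf (g y) (of_nat N) \<partial>M)"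
  proof (rule nn_integral_monotone_convergence_SUP)
    show "incseq (\<lambda>N y. inf (g y) (of_nat N))"
      unfolding incseq_def le_fun_def by (intro allI impI inf_mono order_refl of_nat_mono)
  qed measurable
  also have "\<dots> \<le> B" by (intro SUP_least le_N)
  finally show ?thesis .
qed

theorem mainTheorem5:
  fixes \<C>\<^sub>0 :: "'a::real_vector set set" and \<F> :: "'a set set" and \<tau> :: "'a topology"
    and D :: "'a set" and \<mu> :: "'a measure"
    and M :: "'w measure" and X :: "nat \<Rightarrow> 'w \<Rightarrow> 'a"
  assumes "measurable_lcs \<C>\<^sub>0 \<F> \<tau>"
    and "convex D"
    and "prob_space \<mu>" and "sets \<mu> = \<F>"
    and "carried_by \<mu> D"
    and "iid_sequence M \<mu> X"
    and "convex_tight_on \<tau> \<mu> D"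
  shows "\<forall>f\<in>topological_dual \<tau>.
           pressure M X f = (SUP x. ereal (f x) + entropy \<C>\<^sub>0 (cramer_sequence M \<mu> X) x)"
proof
  fix f assume f: "f \<in> topological_dual \<tau>"
  interpret measurable_lcs_prob \<C>\<^sub>0 \<F> \<tau> \<mu>
    using assms(1,3,4) by (simp add: measurable_lcs_prob_def measurable_lcs_prob_axioms_def)
  let ?S = "SUP x. ereal (f x) + Defs.entropy \<C>\<^sub>0 (cramer_sequence M \<mu> X) x"
  let ?c = "\<integral>\<^sup>+ y. ennreal (exp (f y)) \<partial>\<mu>"
  note [measurable] = dual_measurable[OF f]
  have X1: "X 1 \<in> M \<rightarrow>\<^sub>M \<mu>"
    using assms(6) unfolding iid_sequence_def by (auto simp: prob_space.indep_vars_def)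
  have "distr M \<mu> (X 1) = \<mu>" using assms(6) by (auto simp: iid_sequence_def)
  then have "?c = (\<integral>\<^sup>+ y. ennreal (exp (f y)) \<partial>distr M \<mu> (X 1))" by simp
  also have "\<dots> = (\<integral>\<^sup>+ \<omega>. ennreal (exp (f (X 1 \<omega>))) \<partial>M)" 
    by (intro nn_integral_distr X1) (simp only: measurable_distr_eq1 exp_dual_measurable[OF f])
  finally have p: "pressure M X f = ext_log ?c" by (simp add: pressure_def)
  obtain K where K: "\<And>m. m \<ge> 1 \<Longrightarrow> K m \<in> sets \<mu>" "\<And>m. m \<ge> 1 \<Longrightarrow> convex (K m \<inter> D)"
      "\<And>m. m \<ge> 1 \<Longrightarrow> \<exists>L. compactin \<tau> L \<and> K m \<inter> D \<subseteq> L" "(\<lambda>m. measure \<mu> (K m)) \<longlonglongrightarrow> 1"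
    using assms(7) unfolding convex_tight_on_def by blast
  have "ext_log ?c \<le> ?S"
  \<comment> \<open>It suffices to consider \<open>u > ?S\<close>. For a real \<open>u = a\<close>,
    a number \<open>b\<close> strictly between \<open>?S\<close> and \<open>a\<close> bounds the
    supremum, and the gap up to \<open>a\<close> absorbs the variation of \<open>f\<close> on
    cells.\<close>
  proof (rule dense_ge)
    fix u assume "?S < u"
    show "ext_log ?c \<le> u"
    proof (cases u)
      case (real a)
      then obtain b where b: "?S < ereal b" "b < a"
        using \<open>?S < u\<close> ereal_dense2[of ?S u] by auto
      have less: "ereal (f x) + Defs.entropy \<C>\<^sub>0 (cramer_sequence M \<mu> X) x < ereal b" for x
        using b(1) by (meson SUP_upper UNIV_I le_less_trans)
      have le: "(\<integral>\<^sup>+ y. indicator (K m) y * ennreal (exp (f y)) \<partial>\<mu>) \<le> ennreal (exp a)" if "m \<ge> 1" for m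
        using K(3)[OF that] nn_integral_exp_le_on_convex_compact[OF f assms(6,5) K(1,2)[OF that] _ _ less b(2)]
        by blast
      have "?c \<le> ennreal (exp a)"
        by (rule nn_integral_le_if_exhausted[OF exp_dual_measurable[OF f] K(1,4) le])
      then show ?thesis using ext_log_mono ext_log_exp real by metis
    qed (use \<open>?S < u\<close> in auto)
  qed
  moreover have "?S \<le> ext_log ?c"
    by (intro SUP_least dual_plus_entropy_le f assms(6))
  ultimately show "pressure M X f = ?S" using p by simp
qed

end
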